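(* Let $X$ be a topological space, let $Y$ be a convex set in a topological vector space, and let $T\in KKM(Y,X)$ be compact. Let $A\subseteq X\times Y$ satisfy: (a) $A$ is $T$-properly quasi-convex; (b) the correspondence $G:X\to 2^{Y}$ defined by $G(x)=\{y\in Y:(x,y)\in A\}$ for each $x\in X$ is such that $G^{-1}:Y\to 2^{X}$ is transfer closed-valued. Then there exists $x^{\ast}\in\overline{T(Y)}$ such that $(x^{\ast},y)\in A$ for all $y\in Y$.
   Context: A correspondence $T:Y\to 2^{X}$ assigns to each $y\in Y$ a subset $T(y)\subset X$; $T(B)=\bigcup_{y\in B}T(y)$ for $B\subset Y$. $T$ is compact if $\overline{T(Y)}$ is a compact subset of $X$. For $G:X\to 2^{Y}$, $G^{-1}(y)=\{x\in X:y\in G(x)\}$. $\operatorname{co}$ denotes the convex hull. Given $T,H:Y\to 2^{X}$, $H$ is a generalized KKM mapping w.r.t. $T$ if $T(\operatorname{co}B)\subset H(B)$ for each finite $B\subset Y$. $KKM(Y,X)$ is the set of $T:Y\to 2^{X}$ having the KKM property: for every $H:Y\to 2^{X}$ which is a generalized KKM mapping w.r.t. $T$, the family $\{\overline{H(y)}:y\in Y\}$ has the finite intersection property. $A\subseteq X\times Y$ is $T$-properly quasi-convex if for each integer $n\ge 2$, all $y_1,\dots,y_n\in Y$, each $y\in\operatorname{co}\{y_1,\dots,y_n\}$ and each $x\in T(y)$, there exists $i_0\in\{1,\dots,n\}$ such that $(x,y_{i_0})\in A$. A correspondence $H:Y\to 2^{X}$ is transfer closed-valued if for every $y\in Y$ and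 $x\in X$ with $x\notin H(y)$ there exists $y'\in Y$ such that $x\notin\overline{H(y')}$. *)

theory Defs
  imports "HOL-Analysis.Analysis"
begin

text \<open>Real topological vector spaces; neither separation nor local convexity is assumed.\<close>

class topological_real_vector = real_vector + topological_ab_group_add +
  assumes tendsto_scaleR_Pair:
    "LIM p (nhds c \<times>\<^sub>F nhds x). fst p *\<^sub>R snd p :> nhds (c *\<^sub>R x)"

instance real_normed_vector \<subseteq> topological_real_vector
proof
  fix c :: real and x :: 'a
  show "LIM p (nhds c \<times>\<^sub>F nhds x). fst p *\<^sub>R snd p :> nhds (c *\<^sub>R x)"
    by (intro tendsto_scaleR filterlim_fst filterlim_snd)
qed

text \<open>
  A correspondence from \<open>S\<close> to the subsets of \<open>R\<close> is a set-valued function that is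
  only meaningful on \<open>S\<close>; its values outside \<open>S\<close> are unconstrained and never used.
\<close>

definition correspondences :: "'a set \<Rightarrow> 'b set \<Rightarrow> ('a \<Rightarrow> 'b set) set" where
  "correspondences S R = S \<rightarrow> Pow R"

definition corr_image :: "('a \<Rightarrow> 'b set) \<Rightarrow> 'a set \<Rightarrow> 'b set" where
  "corr_image T B = (\<Union>y\<in>B. T y)"

definition corr_inverse :: "'a set \<Rightarrow> ('a \<Rightarrow> 'b set) \<Rightarrow> 'b \<Rightarrow> 'a set" where
  "corr_inverse S G y = {x \<in> S. y \<in> G x}"

definition compact_corr :: "'y set \<Rightarrow> 'x topology \<Rightarrow> ('y \<Rightarrow> 'x set) \<Rightarrow> bool" where
  "compact_corr Y X T \<longleftrightarrow> compactin X (X closure_of (corr_image T Y))"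

definition finite_intersection_property :: "'x set set \<Rightarrow> bool" where
  "finite_intersection_property \<C> \<longleftrightarrow>
     (\<forall>\<F>. finite \<F> \<and> \<F> \<noteq> {} \<and> \<F> \<subseteq> \<C> \<longrightarrow> \<Inter>\<F> \<noteq> {})"

definition generalized_KKM ::
    "'y::real_vector set \<Rightarrow> ('y \<Rightarrow> 'x set) \<Rightarrow> ('y \<Rightarrow> 'x set) \<Rightarrow> bool" where
  "generalized_KKM Y T H \<longleftrightarrow>
     (\<forall>B. finite B \<and> B \<subseteq> Y \<longrightarrow> corr_image T (convex hull B) \<subseteq> corr_image H B)"

definition KKM :: "'y::real_vector set \<Rightarrow> 'x topology \<Rightarrow> ('y \<Rightarrow> 'x set) set" where
  "KKM Y X =
     {T \<in> correspondences Y (topspace X).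
        \<forall>H \<in> correspondences Y (topspace X). generalized_KKM Y T H \<longrightarrow>
          finite_intersection_property ((\<lambda>y. X closure_of (H y)) ` Y)}"

definition properly_quasi_convex ::
    "'y::real_vector set \<Rightarrow> ('y \<Rightarrow> 'x set) \<Rightarrow> ('x \<times> 'y) set \<Rightarrow> bool" where
  "properly_quasi_convex Y T A \<longleftrightarrow>
     (\<forall>n::nat. \<forall>y::nat \<Rightarrow> 'y. n \<ge> 2 \<and> (\<forall>i\<in>{1..n}. y i \<in> Y) \<longrightarrow>
        (\<forall>z \<in> convex hull (y ` {1..n}). \<forall>x \<in> T z. \<exists>i\<in>{1..n}. (x, y i) \<in> A))"

definition transfer_closed_valued :: "'y set \<Rightarrow> 'x topology \<Rightarrow> ('y \<Rightarrow> 'x set) \<Rightarrow> bool" where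
  "transfer_closed_valued Y X H \<longleftrightarrow>
     (\<forall>y\<in>Y. \<forall>x\<in>topspace X. x \<notin> H y \<longrightarrow> (\<exists>y'\<in>Y. x \<notin> X closure_of (H y')))"

end

theory Submission
  imports Defs
begin

text \<open>
  Write \<open>H y\<close> for the fibre \<open>{x. (x, y) \<in> A}\<close> of \<open>A\<close>. Proper quasi-convexity of \<open>A\<close> is the
  assertion that \<open>H\<close> is a generalized KKM mapping with respect to \<open>T\<close>. The KKM property of \<open>T\<close>
  is however applied to the smaller mapping \<open>H y \<inter> T(Y)\<close>: since \<open>Y\<close> is convex, \<open>T (co B)\<close> lies in
  \<open>T(Y)\<close>, so cutting down to \<open>T(Y)\<close> keeps the generalized KKM condition, and it places all the
  closures inside the compact set \<open>K = closure (T(Y))\<close>. The finite intersection property of these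
  closures, which may fail to have a common point in a non-compact \<open>X\<close>, now yields a point of \<open>K\<close>
  in the closure of every \<open>H y\<close>. Transfer closedness is exactly what makes the intersection of the
  closures of the \<open>H y\<close> coincide with the intersection of the \<open>H y\<close> themselves, so this point
  lies in every fibre.
\<close>

text \<open>
  The definition of proper quasi-convexity speaks of sequences of length at least two. Repeating
  the last entry of an enumeration of \<open>B\<close> makes it long enough even when \<open>B\<close> is a singleton.
\<close>

lemma properly_quasi_convex_imp_generalized_KKM:
  assumes "properly_quasi_convex Y T A"
  shows "generalized_KKM Y T (\<lambda>y. {x. (x, y) \<in> A})"
  unfolding generalized_KKM_def
proof (intro allI impI subsetI)
  fix B x
  assume B: "finite B \<and> B \<subseteq> Y" and "x \<in> corr_image T (convex hull B)"
  then obtain z where z: "z \<in> convex hull B" "x \<in> T z"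
    by (auto simp: corr_image_def)
  then have "B \<noteq> {}" by auto
  with B have pos: "card B \<ge> 1" by (simp add: card_gt_0_iff Suc_le_eq)
  obtain f where "bij_betw f {1..card B} B"
    using ex_bij_betw_nat_finite_1 B by blast
  then have f: "f ` {1..card B} = B" by (simp add: bij_betw_def)
  define y where "y i = f (min i (card B))" for i
  have "(\<lambda>i. min i (card B)) ` {1..Suc (card B)} = {1..card B}"
  proof
    show "{1..card B} \<subseteq> (\<lambda>i. min i (card B)) ` {1..Suc (card B)}"
    proof
      fix i assume "i \<in> {1..card B}"
      then have "i = min i (card B)" "i \<in> {1..Suc (card B)}" by auto
      then show "i \<in> (\<lambda>i. min i (card B)) ` {1..Suc (card B)}" by (rule image_eqI)
    qed
  qed (use pos in auto)
  then have y: "y ` {1..Suc (card B)} = B"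
    unfolding y_def using f by (metis image_image)
  have "Suc (card B) \<ge> 2 \<and> (\<forall>i\<in>{1..Suc (card B)}. y i \<in> Y)"
    using pos y B by auto
  then have "\<exists>i\<in>{1..Suc (card B)}. (x, y i) \<in> A"
    using assms[unfolded properly_quasi_convex_def, rule_format, of "Suc (card B)" y z x] z y
    by auto
  then show "x \<in> corr_image (\<lambda>y. {x. (x, y) \<in> A}) B"
    using y by (auto simp: corr_image_def)
qed

lemma generalized_KKM_Int_corr_image:
  assumes "convex Y" "generalized_KKM Y T H"
  shows "generalized_KKM Y T (\<lambda>y. H y \<inter> corr_image T Y)"
  unfolding generalized_KKM_def
proof (intro allI impI)
  fix B assume B: "finite B \<and> B \<subseteq> Y"
  then have "convex hull B \<subseteq> Y" using assms(1) by (simp add: hull_minimal)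
  then have "corr_image T (convex hull B) \<subseteq> corr_image T Y"
    by (auto simp: corr_image_def)
  moreover have "corr_image T (convex hull B) \<subseteq> corr_image H B"
    using assms(2) B by (simp add: generalized_KKM_def)
  ultimately show "corr_image T (convex hull B) \<subseteq> corr_image (\<lambda>y. H y \<inter> corr_image T Y) B"
    by (fastforce simp: corr_image_def)
qed

text \<open>
  The compactness half of the argument: truncating by \<open>T(Y)\<close> keeps every closure inside the
  compact set \<open>closure (T(Y))\<close>, where the finite intersection property suffices.
\<close>

lemma KKM_compact_common_closure_point:
  assumes "convex Y" "Y \<noteq> {}" "T \<in> KKM Y X" "compact_corr Y X T" "generalized_KKM Y T H"
  shows "\<exists>x \<in> X closure_of (corr_image T Y). \<forall>y\<in>Y. x \<in> X closure_of (H y)"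
proof -
  let ?K = "X closure_of (corr_image T Y)"
  let ?H = "\<lambda>y. H y \<inter> corr_image T Y"
  let ?C = "(\<lambda>y. X closure_of (?H y)) ` Y"
  have "corr_image T Y \<subseteq> topspace X"
    using assms(3) by (auto simp: KKM_def correspondences_def corr_image_def)
  then have "?H \<in> correspondences Y (topspace X)"
    by (auto simp: correspondences_def)
  moreover have "generalized_KKM Y T ?H"
    using assms(1,5) by (rule generalized_KKM_Int_corr_image)
  ultimately have fip: "finite_intersection_property ?C"
    using assms(3) by (simp add: KKM_def)
  have inK: "X closure_of (?H y) \<subseteq> ?K" for y
    by (simp add: closure_of_mono)
  have "?K \<inter> \<Inter>?C \<noteq> {}"
  proof -
    have "?K \<inter> \<Inter>\<F> \<noteq> {}" if \<F>: "finite \<F>" "\<F> \<subseteq> ?C" for \<F>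
    proof -
      obtain y where y: "y \<in> Y" using assms(2) by auto
      \<comment> \<open>Adjoining one closure handles the empty subfamily and supplies membership in \<open>K\<close>.\<close>
      let ?\<G> = "insert (X closure_of (?H y)) \<F>"
      have "finite ?\<G> \<and> ?\<G> \<noteq> {} \<and> ?\<G> \<subseteq> ?C" using \<F> y by auto
      then have "\<Inter>?\<G> \<noteq> {}"
        using fip unfolding finite_intersection_property_def by blast
      then show ?thesis using inK[of y] by blast
    qed
    then have "(\<forall>C\<in>?C. closedin X C) \<and> (\<forall>\<F>. finite \<F> \<and> \<F> \<subseteq> ?C \<longrightarrow> ?K \<inter> \<Inter>\<F> \<noteq> {})"
      by simp
    moreover have "compactin X ?K" using assms(4) by (simp add: compact_corr_def)
    ultimately show ?thesis unfolding compactin_fip by presburger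
  qed
  then obtain x where "x \<in> ?K" and x: "\<forall>y\<in>Y. x \<in> X closure_of (?H y)" by auto
  moreover have "X closure_of (?H y) \<subseteq> X closure_of (H y)" for y
    by (rule closure_of_mono) simp
  ultimately show ?thesis by blast
qed

lemma transfer_closed_valued_common_point:
  assumes "transfer_closed_valued Y X H" "Y \<noteq> {}" "\<forall>y\<in>Y. x \<in> X closure_of (H y)"
  shows "\<forall>y\<in>Y. x \<in> H y"
proof -
  have "x \<in> topspace X" using assms(2,3) by (meson closure_of_subset_topspace ex_in_conv subsetD)
  then show ?thesis using assms(1,3) unfolding transfer_closed_valued_def by blast
qed

theorem theorem2:
  fixes X :: "'x topology"
    and Y :: "'y::topological_real_vector set"
    and T :: "'y \<Rightarrow> 'x set"
    and A :: "('x \<times> 'y) set"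
  assumes "convex Y" and "Y \<noteq> {}"
    and "T \<in> KKM Y X" and "compact_corr Y X T"
    and "A \<subseteq> topspace X \<times> Y"
    and "properly_quasi_convex Y T A"
    and "transfer_closed_valued Y X (corr_inverse (topspace X) (\<lambda>x. {y \<in> Y. (x, y) \<in> A}))"
  shows "\<exists>x \<in> X closure_of (corr_image T Y). \<forall>y\<in>Y. (x, y) \<in> A"
proof -
  let ?H = "corr_inverse (topspace X) (\<lambda>x. {y \<in> Y. (x, y) \<in> A})"
  have H: "?H = (\<lambda>y. {x. (x, y) \<in> A})"
    using assms(5) by (auto simp: corr_inverse_def fun_eq_iff)
  have "generalized_KKM Y T ?H"
    unfolding H using assms(6) by (rule properly_quasi_convex_imp_generalized_KKM)
  then obtain x where x: "x \<in> X closure_of (corr_image T Y)" "\<forall>y\<in>Y. x \<in> X closure_of (?H y)"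
    using KKM_compact_common_closure_point assms(1-4) by blast
  have "\<forall>y\<in>Y. x \<in> ?H y"
    using assms(7,2) x(2) by (rule transfer_closed_valued_common_point)
  then show ?thesis using x(1) unfolding H by blast
qed

end
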